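(* Under complete randomization of clusters, $\tilde{\mathbf d}^c$ provides a tighter variance bound than the matrix $\tilde{\mathbf d}^{AS}$ associated with the Aronow–Samii bound; that is, $n^{-2}y'\tilde{\mathbf d}^c y\le n^{-2}y'\tilde{\mathbf d}^{AS}y$ for all $y\in\mathbb R^{2n}$, where $$\tilde{\mathbf d}^c=\mathbf d+\begin{bmatrix}\mathrm I(\mathbf d_{01}=-1)&\mathrm I(\mathbf d_{01}=-1)\\ \mathrm I(\mathbf d_{01}=-1)&\mathrm I(\mathbf d_{01}=-1)\end{bmatrix},\qquad \tilde{\mathbf d}^{AS}=\mathbf d+\mathrm I(\mathbf d=-1)+\mathrm{diag}\big(\mathrm I(\mathbf d=-1)1_{2n}\big).$$
   Context: Complete randomization of clusters: $n$ units are partitioned into $m$ clusters; $m_1$ clusters are chosen uniformly at random and all their units are treated; units in the remaining $m_0=m-m_1$ clusters are controls; $m_0,m_1\ge2$. $R_{1i}\in\{0,1\}$ is the treatment indicator of unit $i$, $R_{0i}=1-R_{1i}$, $\mathbf R=\mathrm{diag}(R_{01},\dots,R_{0n},R_{11},\dots,R_{1n})$, $\boldsymbol\pi=\mathrm E[\mathbf R]$. $\mathbf d=\mathrm V(1_{2n}'\boldsymbol\pi^{-1}\mathbf R)$ is the $2n\times2n$ variance-covariance matrix of the vector $1_{2n}'\boldsymbol\pi^{-1}\mathbf R$ ($1_{2n}$ the vector of $2n$ ones), partitioned into $n\times n$ blocks $\mathbf d=\begin{bmatrix}\mathbf d_{00}&\mathbf d_{01}\\ \mathbf d_{10}&\mathbf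 d_{11}\end{bmatrix}$; e.g. $\mathbf d_{01}$ has $ij$ entry $\frac{\mathrm P(R_{0i}=1,R_{1j}=1)-\mathrm P(R_{0i}=1)\mathrm P(R_{1j}=1)}{\mathrm P(R_{0i}=1)\mathrm P(R_{1j}=1)}$. For a matrix $A$, $\mathrm I(A=a)$ is the 0/1 matrix of the same size indicating which entries equal $a$; $\mathrm{diag}(v)$ is the diagonal matrix with diagonal $v$. Definition (tighter variance bound): for matrices $\tilde{\mathbf d}^a,\tilde{\mathbf d}^b$ corresponding to variance bounds (i.e. $n^{-2}y'\mathbf d y\le n^{-2}y'\tilde{\mathbf d}y$ for all $y$), $\tilde{\mathbf d}^a$ corresponds to a tighter variance bound than $\tilde{\mathbf d}^b$ if $n^{-2}y'\tilde{\mathbf d}^ay\le n^{-2}y'\tilde{\mathbf d}^by$ for all $y\in\mathbb R^{2n}$. *)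

theory Defs
  imports "HOL-Probability.Probability" "HOL-Library.Disjoint_Sets"
begin

text \<open>
  Units are the elements of a finite type \<open>'n\<close>, so \<open>n = CARD('n)\<close>. Vectors of length \<open>2n\<close> are
  indexed by \<open>'n + 'n\<close>: \<open>Inl i\<close> is position \<open>i\<close> of the first (control) half and \<open>Inr i\<close> is
  position \<open>i\<close> of the second (treatment) half.
\<close>

definition diag_mat :: "real ^ 'k \<Rightarrow> real ^ 'k ^ 'k" where
  "diag_mat v = (\<chi> i j. if i = j then v $ i else 0)"

text \<open>The 0/1 matrix \<open>I(A = a)\<close>.\<close>

definition entries_eq :: "real ^ 'k ^ 'l \<Rightarrow> real \<Rightarrow> real ^ 'k ^ 'l" where
  "entries_eq A a = (\<chi> i j. if A $ i $ j = a then 1 else 0)"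

definition block01 :: "real ^ ('n::finite + 'n) ^ ('n + 'n) \<Rightarrow> real ^ 'n ^ 'n" where
  "block01 A = (\<chi> i j. A $ Inl i $ Inr j)"

definition block_mat ::
  "real ^ 'n::finite ^ 'n \<Rightarrow> real ^ 'n ^ 'n \<Rightarrow> real ^ 'n ^ 'n \<Rightarrow> real ^ 'n ^ 'n \<Rightarrow> real ^ ('n + 'n) ^ ('n + 'n)"
where
  "block_mat A00 A01 A10 A11 = (\<chi> k l.
     (case k of
        Inl i \<Rightarrow> (case l of Inl j \<Rightarrow> A00 $ i $ j | Inr j \<Rightarrow> A01 $ i $ j)
      | Inr i \<Rightarrow> (case l of Inl j \<Rightarrow> A10 $ i $ j | Inr j \<Rightarrow> A11 $ i $ j)))"

definition variance_matrix :: "'s pmf \<Rightarrow> ('s \<Rightarrow> real ^ 'k) \<Rightarrow> real ^ 'k ^ 'k" where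
  "variance_matrix p X = (\<chi> k l. measure_pmf.expectation p
     (\<lambda>s. (X s $ k - measure_pmf.expectation p (\<lambda>s. X s $ k))
        * (X s $ l - measure_pmf.expectation p (\<lambda>s. X s $ l))))"

text \<open>
  An outcome of the randomization is the set of treated clusters. \<open>P\<close> is the partition of the
  units into clusters.
\<close>

definition cluster_randomization :: "'n set set \<Rightarrow> nat \<Rightarrow> 'n set set pmf" where
  "cluster_randomization P m1 = pmf_of_set {S. S \<subseteq> P \<and> card S = m1}"

definition treated :: "'n set set \<Rightarrow> 'n \<Rightarrow> real" where
  "treated S i = (if i \<in> \<Union>S then 1 else 0)"

definition R_mat :: "'n::finite set set \<Rightarrow> real ^ ('n + 'n) ^ ('n + 'n)" where
  "R_mat S = diag_mat (\<chi> k. case k of Inl i \<Rightarrow> 1 - treated S i | Inr i \<Rightarrow> treated S i)"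

definition pi_mat :: "'n::finite set set pmf \<Rightarrow> real ^ ('n + 'n) ^ ('n + 'n)" where
  "pi_mat p = measure_pmf.expectation p R_mat"

text \<open>\<open>1 :: real ^ 'k\<close> is the all-ones vector.\<close>

definition d_mat :: "'n::finite set set pmf \<Rightarrow> real ^ ('n + 'n) ^ ('n + 'n)" where
  "d_mat p = variance_matrix p (\<lambda>S. 1 v* (matrix_inv (pi_mat p) ** R_mat S))"

definition dc_mat :: "real ^ ('n::finite + 'n) ^ ('n + 'n) \<Rightarrow> real ^ ('n + 'n) ^ ('n + 'n)" where
  "dc_mat d = (let I = entries_eq (block01 d) (- 1) in d + block_mat I I I I)"

definition dAS_mat :: "real ^ ('n::finite + 'n) ^ ('n + 'n) \<Rightarrow> real ^ ('n + 'n) ^ ('n + 'n)" where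
  "dAS_mat d = d + entries_eq d (- 1) + diag_mat (entries_eq d (- 1) *v 1)"

definition scaled_quad :: "real ^ ('n::finite + 'n) ^ ('n + 'n) \<Rightarrow> real ^ ('n + 'n) \<Rightarrow> real" where
  "scaled_quad A y = (y \<bullet> (A *v y)) / (real CARD('n))\<^sup>2"

definition variance_bound ::
  "real ^ ('n::finite + 'n) ^ ('n + 'n) \<Rightarrow> real ^ ('n + 'n) ^ ('n + 'n) \<Rightarrow> bool" where
  "variance_bound d A \<longleftrightarrow> (\<forall>y. scaled_quad d y \<le> scaled_quad A y)"

text \<open>Tightness is only defined between matrices that both correspond to variance bounds,
  so this is part of the predicate. Tighter is meant in the weak sense.\<close>

definition tighter_variance_bound ::
  "real ^ ('n::finite + 'n) ^ ('n + 'n) \<Rightarrow> real ^ ('n + 'n) ^ ('n + 'n)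
     \<Rightarrow> real ^ ('n + 'n) ^ ('n + 'n) \<Rightarrow> bool" where
  "tighter_variance_bound d A B \<longleftrightarrow> variance_bound d A \<and> variance_bound d B \<and>
     (\<forall>y. scaled_quad A y \<le> scaled_quad B y)"

end

theory Submission
  imports Defs
begin

text \<open>
  An entry of \<open>d\<close> is \<open>- 1\<close> exactly when the two assignment indicators are never both \<open>1\<close>. Since
  \<open>m0, m1 \<ge> 2\<close>, this happens only for a control and a treatment indicator within one cluster, so
  \<open>I(d = - 1)\<close> has diagonal blocks \<open>0\<close> and off-diagonal blocks \<open>C\<close>, where \<open>C\<close> is the 0/1 matrix
  of the relation ``same cluster''. Writing \<open>y = (u, v)\<close>, the matrix \<open>dc - d\<close> has the quadratic
  form \<open>(u + v)' C (u + v)\<close>, a sum of squares over the clusters, and the quadratic form of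
  \<open>dAS - dc\<close> is the sum of the Laplacian forms \<open>1/2 \<Sum> C i j (u i - u j)\<^sup>2\<close> at \<open>u\<close> and at \<open>v\<close>.
\<close>

section \<open>Diagonal matrices and their inverses\<close>

lemma diag_mat_mult: "diag_mat v ** diag_mat w = diag_mat (\<chi> k. v $ k * w $ k)"
proof -
  have "(\<Sum>k\<in>UNIV. (if i = k then v $ i else 0) * (if k = j then w $ k else 0))
      = (if i = j then v $ i * w $ i else 0)" for i j
  proof -
    have "(\<Sum>k\<in>UNIV. (if i = k then v $ i else 0) * (if k = j then w $ k else 0))
        = (\<Sum>k\<in>UNIV. if i = k then v $ i * (if k = j then w $ k else 0) else 0)"
      by (rule sum.cong) auto
    then show ?thesis by simp
  qed
  then show ?thesis
    by (simp add: diag_mat_def matrix_matrix_mult_def vec_eq_iff)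
qed

lemma one_vector_mult_diag_mat: "1 v* diag_mat v = v"
  by (simp add: diag_mat_def vector_matrix_mult_def vec_eq_iff)

lemma matrix_inv_unique:
  fixes A :: "'a::semiring_1 ^ 'n ^ 'm"
  assumes "A ** B = mat 1" "B ** A = mat 1"
  shows "matrix_inv A = B"
  unfolding matrix_inv_def
proof (rule some_equality)
  fix B' assume "A ** B' = mat 1 \<and> B' ** A = mat 1"
  then show "B' = B"
    using assms by (metis matrix_mul_assoc matrix_mul_lid matrix_mul_rid)
qed (use assms in simp)

lemma matrix_inv_diag_mat:
  assumes "\<And>k. v $ k \<noteq> 0"
  shows "matrix_inv (diag_mat v) = diag_mat (\<chi> k. 1 / v $ k)"
proof (rule matrix_inv_unique)
  have "diag_mat (1 :: real ^ 'a) = mat 1"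
    by (simp add: diag_mat_def mat_def vec_eq_iff)
  moreover have "(\<chi> k. v $ k * (\<chi> k. 1 / v $ k) $ k) = 1" "(\<chi> k. (\<chi> k. 1 / v $ k) $ k * v $ k) = 1"
    using assms by (simp_all add: vec_eq_iff)
  ultimately show "diag_mat v ** diag_mat (\<chi> k. 1 / v $ k) = mat 1"
    and "diag_mat (\<chi> k. 1 / v $ k) ** diag_mat v = mat 1"
    by (simp_all add: diag_mat_mult)
qed

section \<open>Entries of \<open>pi_mat p\<close> and \<open>d_mat p\<close>\<close>

lemma pi_mat_nth:
  "pi_mat p $ k $ l = measure_pmf.expectation p (\<lambda>S. R_mat S $ k $ l)"
proof -
  \<comment> \<open>Since \<open>'n\<close> is finite, so is the type of outcomes; the expectation
    is a finite sum and can be taken entry by entry.\<close>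
  have fin: "finite (set_pmf p)" by simp
  show ?thesis
    unfolding pi_mat_def
    by (simp add: integral_measure_pmf[OF fin])
qed

lemma pi_mat_diag:
  "pi_mat p = diag_mat (\<chi> k. measure_pmf.expectation p (\<lambda>S. R_mat S $ k $ k))"
  unfolding vec_eq_iff by (auto simp: pi_mat_nth diag_mat_def R_mat_def)

text \<open>Both matrices in the definition are diagonal, so coordinate \<open>k\<close> of the
  random vector is the indicator divided by its own mean. Each coordinate then has mean 1, and
  expanding the covariance leaves a normalized joint expectation minus 1. Positivity of the means
  makes \<open>pi_mat p\<close> invertible.\<close>

lemma d_mat_nth:
  fixes p :: "'n::finite set set pmf"
  assumes pos: "\<And>k. measure_pmf.expectation p (\<lambda>S. R_mat S $ k $ k) > 0"
  shows "d_mat p $ k $ l = measure_pmf.expectation p (\<lambda>S. R_mat S $ k $ k * R_mat S $ l $ l)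
      / (measure_pmf.expectation p (\<lambda>S. R_mat S $ k $ k)
         * measure_pmf.expectation p (\<lambda>S. R_mat S $ l $ l)) - 1"
proof -
  let ?E = "measure_pmf.expectation p"
  define w where "w k = ?E (\<lambda>S. R_mat S $ k $ k)" for k
  have w: "w k > 0" for k using pos by (simp add: w_def)
  have int: "integrable p f" for f :: "_ \<Rightarrow> real"
    by (rule integrable_measure_pmf_finite) simp
  have "R_mat S = diag_mat (\<chi> k. R_mat S $ k $ k)" for S :: "'n set set"
    by (simp add: R_mat_def diag_mat_def vec_eq_iff)
  moreover have "matrix_inv (pi_mat p) = diag_mat (\<chi> k. 1 / w k)"
    using w unfolding pi_mat_diag w_def[symmetric]
    by (subst matrix_inv_diag_mat) (simp_all add: less_imp_neq[symmetric])
  ultimately have "matrix_inv (pi_mat p) ** R_mat S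
      = diag_mat (\<chi> k. 1 / w k) ** diag_mat (\<chi> k. R_mat S $ k $ k)" for S
    by metis
  then have X: "(1 v* (matrix_inv (pi_mat p) ** R_mat S)) $ k = R_mat S $ k $ k / w k" for S k
    by (simp add: diag_mat_mult one_vector_mult_diag_mat)
  have EX: "?E (\<lambda>S. R_mat S $ k $ k / w k) = 1" for k
    using w[of k] by (simp add: w_def)
  have "d_mat p $ k $ l = ?E (\<lambda>S. (R_mat S $ k $ k / w k - 1) * (R_mat S $ l $ l / w l - 1))"
    by (simp only: d_mat_def variance_matrix_def X EX vec_lambda_beta)
  also have "\<dots> = ?E (\<lambda>S. R_mat S $ k $ k * R_mat S $ l $ l / (w k * w l)
      - R_mat S $ k $ k / w k - R_mat S $ l $ l / w l + 1)"
    by (simp add: algebra_simps)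
  also have "\<dots> = ?E (\<lambda>S. R_mat S $ k $ k * R_mat S $ l $ l / (w k * w l)) - 1"
    by (simp only: Bochner_Integration.integral_add[OF int int]
        Bochner_Integration.integral_diff[OF int int] EX) simp
  finally show ?thesis by (simp add: w_def)
qed

section \<open>Entries of \<open>d\<close> equal to -1\<close>

lemma R_mat_diag [simp]:
  "R_mat S $ Inl i $ Inl i = 1 - treated S i" "R_mat S $ Inr i $ Inr i = treated S i"
  by (simp_all add: R_mat_def diag_mat_def)

lemma R_mat_diag_nonneg: "R_mat S $ k $ k \<ge> 0"
  by (cases k) (simp_all add: treated_def)

text \<open>On a finite support the expectation is a sum of nonnegative terms with positive weights,
  so it vanishes only if every term does.\<close>

lemma expectation_pos_iff:
  fixes f :: "'a \<Rightarrow> real"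
  assumes "finite (set_pmf p)" and "\<And>x. f x \<ge> 0"
  shows "measure_pmf.expectation p f > 0 \<longleftrightarrow> (\<exists>x\<in>set_pmf p. f x > 0)"
proof -
  have "measure_pmf.expectation p f = (\<Sum>x\<in>set_pmf p. pmf p x * f x)"
    using integral_measure_pmf[OF assms(1), of p f] by (simp add: set_pmf_iff)
  moreover have "(\<Sum>x\<in>set_pmf p. pmf p x * f x) \<ge> 0"
    by (intro sum_nonneg mult_nonneg_nonneg assms) simp
  moreover have "(\<Sum>x\<in>set_pmf p. pmf p x * f x) = 0 \<longleftrightarrow> (\<forall>x\<in>set_pmf p. f x = 0)"
    using assms by (subst sum_nonneg_eq_0_iff) (auto simp: set_pmf_iff)
  ultimately show ?thesis
    using assms(2) by (metis less_eq_real_def less_irrefl)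
qed

text \<open>By \<open>d_mat_nth\<close> the value -1 means a vanishing joint expectation. This
  reduces the question to which outcomes are possible, so no probability has to be computed.\<close>

lemma d_mat_eq_minus_one_iff:
  fixes p :: "'n::finite set set pmf"
  assumes pos: "\<And>k. \<exists>S\<in>set_pmf p. R_mat S $ k $ k > 0"
  shows "d_mat p $ k $ l = - 1 \<longleftrightarrow> \<not> (\<exists>S\<in>set_pmf p. R_mat S $ k $ k * R_mat S $ l $ l > 0)"
proof -
  have nonneg: "R_mat S $ k $ k * R_mat S $ l $ l \<ge> 0" for S
    by (intro mult_nonneg_nonneg R_mat_diag_nonneg)
  have E: "measure_pmf.expectation p (\<lambda>S. R_mat S $ k $ k) > 0" for k
    using pos by (subst expectation_pos_iff) (auto simp: R_mat_diag_nonneg)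
  have "measure_pmf.expectation p (\<lambda>S. R_mat S $ k $ k * R_mat S $ l $ l) \<ge> 0"
    using nonneg by simp
  moreover have "measure_pmf.expectation p (\<lambda>S. R_mat S $ k $ k * R_mat S $ l $ l) > 0
      \<longleftrightarrow> (\<exists>S\<in>set_pmf p. R_mat S $ k $ k * R_mat S $ l $ l > 0)"
    using nonneg by (intro expectation_pos_iff) auto
  ultimately show ?thesis
    using E[of k] E[of l] unfolding d_mat_nth[OF E] by auto
qed

section \<open>Outcomes of the cluster randomization\<close>

lemma set_pmf_cluster_randomization:
  fixes P :: "'n::finite set set"
  assumes "m1 \<le> card P"
  shows "set_pmf (cluster_randomization P m1) = {S. S \<subseteq> P \<and> card S = m1}"
proof -
  have "{S. S \<subseteq> P \<and> card S = m1} \<noteq> {}"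
    using obtain_subset_with_card_n[OF assms] by blast
  then show ?thesis
    unfolding cluster_randomization_def by (intro set_pmf_of_set) auto
qed

text \<open>\<open>T\<close> is to be treated and \<open>U\<close> to be left as control. Any set of
  size \<open>m1\<close> between \<open>T\<close> and \<open>P - U\<close> is such an outcome, and
  the cardinality assumptions leave room for one.\<close>

lemma cluster_randomization_separates:
  fixes P :: "'n::finite set set"
  assumes "T \<subseteq> P" "U \<subseteq> P" "T \<inter> U = {}" "card T \<le> m1" "m1 + card U \<le> card P"
  shows "\<exists>S\<in>set_pmf (cluster_randomization P m1). T \<subseteq> S \<and> S \<inter> U = {}"
proof -
  have "m1 \<le> card (P - U)"
    using assms by (simp add: card_Diff_subset)
  then obtain S where "T \<subseteq> S" "S \<subseteq> P - U" "card S = m1"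
    using exists_subset_between[of T m1 "P - U"] assms by auto
  then show ?thesis
    using assms by (subst set_pmf_cluster_randomization) auto
qed

lemma treated_eq:
  assumes "partition_on UNIV P" "S \<subseteq> P" "A \<in> P" "i \<in> A"
  shows "treated S i = (if A \<in> S then 1 else 0)"
proof -
  have "B = A" if "B \<in> S" "i \<in> B" for B
    using assms that partition_onD2[OF assms(1)] unfolding disjoint_def by blast
  then show ?thesis
    using assms by (auto simp: treated_def)
qed

text \<open>Two units involve at most two clusters, so with two treated and two control clusters
  available they can share either assignment. Opposite assignments are possible exactly when their
  clusters differ. The function \<open>cl\<close> selects the cluster of each unit.\<close>

lemma d_mat_cluster_randomization_eq_minus_one:
  fixes P :: "'n::finite set set" and cl :: "'n \<Rightarrow> 'n set"
  assumes part: "partition_on UNIV P" and m0: "m1 + 2 \<le> card P" and m1: "2 \<le> m1"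
    and cl: "\<And>i. cl i \<in> P" "\<And>i. i \<in> cl i"
  defines "d \<equiv> d_mat (cluster_randomization P m1)"
  shows "d $ Inl i $ Inl j \<noteq> - 1" "d $ Inr i $ Inr j \<noteq> - 1"
    and "d $ Inl i $ Inr j = - 1 \<longleftrightarrow> cl i = cl j" "d $ Inr i $ Inl j = - 1 \<longleftrightarrow> cl i = cl j"
proof -
  let ?p = "cluster_randomization P m1"
  have tr: "treated S i = (if cl i \<in> S then 1 else 0)" if "S \<in> set_pmf ?p" for S i
    using treated_eq[OF part _ cl(1) cl(2)] that set_pmf_cluster_randomization[of m1 P] m0 by auto
  have card2: "card {cl i, cl j} \<le> 2" for i j
    by (simp add: card_insert_if)
  have both1: "\<exists>S\<in>set_pmf ?p. cl i \<in> S \<and> cl j \<in> S" for i j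
    using cluster_randomization_separates[of "{cl i, cl j}" P "{}" m1] cl m0 m1 card2[of i j] by auto
  have both0: "\<exists>S\<in>set_pmf ?p. cl i \<notin> S \<and> cl j \<notin> S" for i j
    using cluster_randomization_separates[of "{}" P "{cl i, cl j}" m1] cl m0 m1 card2[of i j] by auto
  have cross: "\<exists>S\<in>set_pmf ?p. cl i \<notin> S \<and> cl j \<in> S" if "cl i \<noteq> cl j" for i j
    using cluster_randomization_separates[of "{cl j}" P "{cl i}" m1] cl m0 m1 that by auto
  \<comment> \<open>Each single assignment is the case \<open>i = j\<close> of a shared one.\<close>
  have pos: "\<exists>S\<in>set_pmf ?p. R_mat S $ k $ k > 0" for k
  proof (cases k)
    case (Inl i)
    then show ?thesis using both0[of i i] by (auto simp: tr intro!: bexI)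
  next
    case (Inr i)
    then show ?thesis using both1[of i i] by (auto simp: tr intro!: bexI)
  qed
  note iff = d_mat_eq_minus_one_iff[OF pos, folded d_def]
  show "d $ Inl i $ Inl j \<noteq> - 1"
    unfolding iff using both0[of i j] by (force simp: tr)
  show "d $ Inr i $ Inr j \<noteq> - 1"
    unfolding iff using both1[of i j] by (force simp: tr)
  show "d $ Inl i $ Inr j = - 1 \<longleftrightarrow> cl i = cl j"
    unfolding iff using cross[of i j] by (force simp: tr)
  show "d $ Inr i $ Inl j = - 1 \<longleftrightarrow> cl i = cl j"
    unfolding iff using cross[of j i] by (force simp: tr)
qed

section \<open>Quadratic forms of block, kernel and diagonal matrices\<close>

lemma sum_UNIV_Plus:
  fixes f :: "'a::finite + 'b::finite \<Rightarrow> 'c::comm_monoid_add"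
  shows "sum f UNIV = (\<Sum>i\<in>UNIV. f (Inl i)) + (\<Sum>i\<in>UNIV. f (Inr i))"
  by (simp add: UNIV_Plus_UNIV[symmetric] sum.Plus comp_def del: UNIV_Plus_UNIV)

lemma quadratic_form_eq:
  fixes A :: "real ^ 'k ^ 'k"
  shows "y \<bullet> (A *v y) = (\<Sum>k\<in>UNIV. \<Sum>l\<in>UNIV. A $ k $ l * (y $ k * y $ l))"
  by (simp add: inner_vec_def matrix_vector_mult_def sum_distrib_left algebra_simps)

text \<open>The 0/1 kernel of \<open>f\<close> is a sum of rank-one matrices, one for each value
  \<open>a\<close> of \<open>f\<close>, so the form is the sum over the fibres of \<open>f\<close>
  of the squared fibre totals of \<open>u\<close>.\<close>

lemma kernel_form_nonneg:
  fixes f :: "'a::finite \<Rightarrow> 'b" and u :: "'a \<Rightarrow> real"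
  shows "(\<Sum>i\<in>UNIV. \<Sum>j\<in>UNIV. of_bool (f i = f j) * (u i * u j)) \<ge> 0"
proof -
  have "(\<Sum>i\<in>UNIV. \<Sum>j\<in>UNIV. of_bool (f i = f j) * (u i * u j))
      = (\<Sum>i\<in>UNIV. \<Sum>j\<in>UNIV. \<Sum>a\<in>range f. (of_bool (f i = a) * u i) * (of_bool (f j = a) * u j))"
  proof (intro sum.cong refl)
    fix i j
    have "(\<Sum>a\<in>range f. (of_bool (f i = a) * u i) * (of_bool (f j = a) * u j))
        = (\<Sum>a\<in>range f. if f i = a then of_bool (f j = a) * (u i * u j) else 0)"
      by (rule sum.cong) auto
    then show "of_bool (f i = f j) * (u i * u j)
        = (\<Sum>a\<in>range f. (of_bool (f i = a) * u i) * (of_bool (f j = a) * u j))"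
      by (auto simp: eq_commute)
  qed
  also have "\<dots> = (\<Sum>i\<in>UNIV. \<Sum>a\<in>range f. \<Sum>j\<in>UNIV.
      (of_bool (f i = a) * u i) * (of_bool (f j = a) * u j))"
    by (intro sum.cong refl sum.swap)
  also have "\<dots> = (\<Sum>a\<in>range f. \<Sum>i\<in>UNIV. \<Sum>j\<in>UNIV.
      (of_bool (f i = a) * u i) * (of_bool (f j = a) * u j))"
    by (rule sum.swap)
  also have "\<dots> = (\<Sum>a\<in>range f. (\<Sum>i\<in>UNIV. of_bool (f i = a) * u i)\<^sup>2)"
    by (simp only: power2_eq_square sum_product)
  also have "\<dots> \<ge> 0"
    by (intro sum_nonneg) auto
  finally show ?thesis .
qed

text \<open>Expand the nonnegative sum of \<open>(u i - u j)\<^sup>2\<close> over pairs in a common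
  fibre: by symmetry its two square terms agree, so it is twice the difference of the two
  sides.\<close>

lemma kernel_laplacian_nonneg:
  fixes f :: "'a::finite \<Rightarrow> 'b" and u :: "'a \<Rightarrow> real"
  shows "(\<Sum>i\<in>UNIV. \<Sum>j\<in>UNIV. of_bool (f i = f j) * (u i * u j))
      \<le> (\<Sum>i\<in>UNIV. \<Sum>j\<in>UNIV. of_bool (f i = f j) * (u i)\<^sup>2)"
proof -
  have "(\<Sum>i\<in>UNIV. \<Sum>j\<in>UNIV. of_bool (f i = f j) * (u j)\<^sup>2)
      = (\<Sum>i\<in>UNIV. \<Sum>j\<in>UNIV. of_bool (f i = f j) * (u i)\<^sup>2)"
    by (subst sum.swap) (simp add: eq_commute)
  moreover have "0 \<le> (\<Sum>i\<in>UNIV. \<Sum>j\<in>UNIV. of_bool (f i = f j) * (u i - u j)\<^sup>2)"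
    by (intro sum_nonneg) auto
  ultimately show ?thesis
    unfolding power2_diff ring_distribs sum.distrib sum_subtractf mult.assoc
      mult.left_commute[of _ 2] sum_distrib_left[symmetric, of 2]
    by linarith
qed

lemma quadratic_form_diag_mat: "y \<bullet> (diag_mat v *v y) = (\<Sum>k\<in>UNIV. v $ k * (y $ k)\<^sup>2)"
proof -
  have "(diag_mat v *v y) $ k = v $ k * y $ k" for k
    by (simp add: matrix_vector_mult_def diag_mat_def if_distrib[of "\<lambda>x. x * _"] cong: if_cong)
  then show ?thesis
    by (simp add: inner_vec_def power2_eq_square algebra_simps)
qed

theorem theorem7p14:
  fixes P :: "'n::finite set set" and m m0 m1 :: nat
    and d :: "real ^ ('n + 'n) ^ ('n + 'n)"
  assumes "partition_on UNIV P"
    and "card P = m"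
    and "m0 = m - m1"
    and "m0 \<ge> 2"
    and "m1 \<ge> 2"
    and "d = d_mat (cluster_randomization P m1)"
  shows "tighter_variance_bound d (dc_mat d) (dAS_mat d)"
proof -
  have "\<forall>i. \<exists>A. A \<in> P \<and> i \<in> A"
    using partition_onD1[OF assms(1)] by blast
  then obtain cl where cl: "\<And>i. cl i \<in> P" "\<And>i. i \<in> cl i"
    by metis
  \<comment> \<open>The subtraction in \<open>m0 = m - m1\<close> is truncated, but
    \<open>m0 \<ge> 2\<close> rules out truncation.\<close>
  have "m1 + 2 \<le> card P" using assms by simp
  note entries = d_mat_cluster_randomization_eq_minus_one[OF assms(1) this assms(5) cl,
      folded assms(6)]
  define C where "C i j = (of_bool (cl i = cl j) :: real)" for i j
  define D where "D k l = (of_bool (d $ k $ l = - 1) :: real)" for k l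
  have D: "D (Inl i) (Inl j) = 0" "D (Inr i) (Inr j) = 0"
    "D (Inl i) (Inr j) = C i j" "D (Inr i) (Inl j) = C i j" for i j
    using entries by (simp_all add: C_def D_def)
  \<comment> \<open>\<open>qC\<close> is the form of \<open>C\<close>, \<open>dC\<close> that of the
    diagonal matrix of the row sums of \<open>C\<close> (the cluster sizes), and
    \<open>cross\<close> the bilinear form of \<open>C\<close>.\<close>
  define qC where "qC u = (\<Sum>i\<in>UNIV. \<Sum>j\<in>UNIV. C i j * (u i * u j))" for u :: "'n \<Rightarrow> real"
  define dC where "dC u = (\<Sum>i\<in>UNIV. \<Sum>j\<in>UNIV. C i j * (u i)\<^sup>2)" for u :: "'n \<Rightarrow> real"
  define cross where "cross u v = (\<Sum>i\<in>UNIV. \<Sum>j\<in>UNIV. C i j * (u i * v j))"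
    for u v :: "'n \<Rightarrow> real"
  have qC_nonneg: "qC u \<ge> 0" for u
    unfolding qC_def C_def by (rule kernel_form_nonneg)
  have qC_le: "qC u \<le> dC u" for u
    unfolding qC_def dC_def C_def by (rule kernel_laplacian_nonneg)
  have qC_add: "qC (\<lambda>i. u i + v i) = qC u + cross u v + cross v u + qC v" for u v
    by (simp add: qC_def cross_def algebra_simps sum.distrib)
  have dc: "y \<bullet> (dc_mat d *v y) = y \<bullet> (d *v y) + qC (\<lambda>i. y $ Inl i + y $ Inr i)" for y
  proof -
    define I where "I = entries_eq (block01 d) (- 1)"
    have I: "I $ i $ j = C i j" for i j
      using entries by (simp add: I_def entries_eq_def block01_def C_def)
    have "y \<bullet> (block_mat I I I I *v y) = qC (\<lambda>i. y $ Inl i + y $ Inr i)"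
      unfolding quadratic_form_eq sum_UNIV_Plus qC_add
      by (simp add: block_mat_def I qC_def cross_def sum.distrib)
    then show ?thesis
      unfolding dc_mat_def Let_def I_def[symmetric]
      by (simp add: matrix_vector_mult_add_rdistrib inner_add_right)
  qed
  have dAS: "y \<bullet> (dAS_mat d *v y) = y \<bullet> (d *v y)
      + (cross (\<lambda>i. y $ Inl i) (\<lambda>i. y $ Inr i) + cross (\<lambda>i. y $ Inr i) (\<lambda>i. y $ Inl i))
      + (dC (\<lambda>i. y $ Inl i) + dC (\<lambda>i. y $ Inr i))" for y
  proof -
    define J where "J = entries_eq d (- 1)"
    have J: "J $ k $ l = D k l" for k l
      by (simp add: J_def entries_eq_def D_def)
    have "y \<bullet> (J *v y)
        = cross (\<lambda>i. y $ Inl i) (\<lambda>i. y $ Inr i) + cross (\<lambda>i. y $ Inr i) (\<lambda>i. y $ Inl i)"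
      unfolding quadratic_form_eq sum_UNIV_Plus by (simp add: J D cross_def)
    \<comment> \<open>In each row of \<open>J\<close> only the off-diagonal block contributes, so
      the row sums in both halves are row sums of \<open>C\<close>.\<close>
    moreover have "y \<bullet> (diag_mat (J *v 1) *v y) = dC (\<lambda>i. y $ Inl i) + dC (\<lambda>i. y $ Inr i)"
      unfolding quadratic_form_diag_mat
      by (simp add: matrix_vector_mult_def J sum_UNIV_Plus D dC_def sum_distrib_right)
    ultimately show ?thesis
      unfolding dAS_mat_def J_def[symmetric]
      by (simp add: matrix_vector_mult_add_rdistrib inner_add_right)
  qed
  have c_bound: "scaled_quad d y \<le> scaled_quad (dc_mat d) y" for y
    unfolding scaled_quad_def dc by (intro divide_right_mono) (simp_all add: qC_nonneg)
  \<comment> \<open>The cross terms of \<open>qC_add\<close> are exactly those in \<open>dAS\<close>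
    and cancel, leaving \<open>qC_le\<close> for each half of \<open>y\<close>.\<close>
  have c_le_AS: "scaled_quad (dc_mat d) y \<le> scaled_quad (dAS_mat d) y" for y
    unfolding scaled_quad_def dc dAS qC_add
    using qC_le[of "\<lambda>i. y $ Inl i"] qC_le[of "\<lambda>i. y $ Inr i"]
    by (intro divide_right_mono) simp_all
  show ?thesis
    \<comment> \<open>That \<open>dAS_mat d\<close> is itself a variance bound follows by
      transitivity through \<open>dc_mat d\<close>.\<close>
    unfolding tighter_variance_bound_def variance_bound_def
    using c_bound c_le_AS order_trans by blast
qed

end
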